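(* Let $f(s)=2+e^{-3s}(s+1)\left(1-\frac{s^2}{2}-\frac{s^3}{3}-\frac{s^4}{8}\right)+e^{-2s}\left(2s+\frac{5s^2}{2}+\frac{s^3}{2}\right)-e^{-s}\left(3+2s\right)$, and let $\beta\approx 1.26575$ be the positive root of $f(s)-1=0$. Then $C_{\mathtt{HAM}}\ge \beta$, where $\mathtt{HAM}$ is the property of containing a Hamiltonian cycle.
   Context: The semi-random graph process on vertex set $[n]=\{1,\dots,n\}$: start with the empty graph $G_0$ on $[n]$. In each round $t=1,2,\dots$, a vertex $u_t$ is chosen independently and uniformly at random from $[n]$; a strategy then chooses a vertex $v_t\in[n]\setminus\{u_t\}$ (deterministically or according to a distribution), where the choice may depend on $u_1,v_1,\dots,u_{t-1},v_{t-1},u_t$; the edge $u_tv_t$ is added, giving the multigraph $G_t$. For an increasing graph property $\mathcal P$, a strategy $\mathcal S$ and $0<q<1$, let $m_{\mathcal P}(\mathcal S,q,n)$ be the minimum $t\ge 0$ with $\mathbb P[G_t\in\mathcal P]\ge q$ (or $\infty$ if none), let $m_{\mathcal P}(q,n)=\inf_{\mathcal S} m_{\mathcal P}(\mathcal S,q,n)$, and define $C_{\mathcal P}=\lim_{q\to 1^-}\limsup_{n\to\infty} m_{\mathcal P}(q,n)/n$. *)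

theory Defs
  imports "HOL-Probability.Probability" "HOL-Library.Multiset"
begin

text \<open>A multigraph on \<open>{1..n}\<close> is given by its multiset of edges, an edge being a two-element
  vertex set. A strategy maps the history \<open>[(u\<^sub>1, v\<^sub>1), \<dots>, (u\<^sub>t\<^sub>-\<^sub>1, v\<^sub>t\<^sub>-\<^sub>1)]\<close> and the
  current random vertex \<open>u\<^sub>t\<close> to the distribution of \<open>v\<^sub>t\<close>; deterministic choices are point
  masses.\<close>

type_synonym multigraph = "nat set multiset"
type_synonym strategy = "(nat \<times> nat) list \<Rightarrow> nat \<Rightarrow> nat pmf"

definition is_strategy :: "nat \<Rightarrow> strategy \<Rightarrow> bool" where
  "is_strategy n S \<longleftrightarrow> (\<forall>h. \<forall>u\<in>{1..n}. set_pmf (S h u) \<subseteq> {1..n} - {u})"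

primrec history :: "nat \<Rightarrow> strategy \<Rightarrow> nat \<Rightarrow> (nat \<times> nat) list pmf" where
  "history n S 0 = return_pmf []"
| "history n S (Suc t) =
     bind_pmf (history n S t) (\<lambda>h.
     bind_pmf (pmf_of_set {1..n}) (\<lambda>u.
     bind_pmf (S h u) (\<lambda>v. return_pmf (h @ [(u, v)]))))"

definition semi_random_graph :: "nat \<Rightarrow> strategy \<Rightarrow> nat \<Rightarrow> multigraph pmf" where
  "semi_random_graph n S t = map_pmf (\<lambda>h. mset (map (\<lambda>(u, v). {u, v}) h)) (history n S t)"

text \<open>In a graph property \<open>P n G\<close>, the number \<open>n\<close> says that the vertex set of \<open>G\<close> is \<open>{1..n}\<close>.
  Infima in \<^typ>\<open>enat\<close> over the empty set are \<open>\<infinity>\<close>.\<close>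

type_synonym graph_property = "nat \<Rightarrow> multigraph \<Rightarrow> bool"

definition rounds_of :: "graph_property \<Rightarrow> strategy \<Rightarrow> real \<Rightarrow> nat \<Rightarrow> enat" where
  "rounds_of P S q n =
     (INF t \<in> {t. measure_pmf.prob (semi_random_graph n S t) {G. P n G} \<ge> q}. enat t)"

definition rounds :: "graph_property \<Rightarrow> real \<Rightarrow> nat \<Rightarrow> enat" where
  "rounds P q n = (INF S \<in> {S. is_strategy n S}. rounds_of P S q n)"

definition C_const :: "graph_property \<Rightarrow> ereal" where
  "C_const P = Lim (at_left (1::real))
     (\<lambda>q. limsup (\<lambda>n. ereal_of_enat (rounds P q n) / ereal (real n)))"

lemma rounds_mono: "q \<le> q' \<Longrightarrow> rounds P q n \<le> rounds P q' n"
  unfolding rounds_def rounds_of_def by (intro INF_mono') (auto intro!: INF_superset_mono)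

lemma C_const_tendsto:
  "((\<lambda>q. limsup (\<lambda>n. ereal_of_enat (rounds P q n) / ereal (real n))) \<longlongrightarrow> C_const P) (at_left 1)"
proof -
  let ?g = "\<lambda>q. limsup (\<lambda>n. ereal_of_enat (rounds P q n) / ereal (real n))"
  have "?g a \<le> ?g b" if "a \<le> b" for a b
    unfolding divide_ereal_def
    by (intro Limsup_mono always_eventually allI ereal_mult_right_mono)
       (auto simp: rounds_mono[OF that])
  then have "(?g \<longlongrightarrow> Sup (?g ` ({..<1} \<inter> UNIV))) (at 1 within ({..<1} \<inter> UNIV))"
    by (intro Lim_left_bound[where K = \<infinity>]) auto
  then have lim: "(?g \<longlongrightarrow> Sup (?g ` {..<1})) (at_left 1)"
    by simp
  from tendsto_Lim[OF _ this] have "C_const P = Sup (?g ` {..<1})"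
    unfolding C_const_def by simp
  with lim show ?thesis by simp
qed

definition HAM :: graph_property where
  "HAM n G \<longleftrightarrow> n \<ge> 3 \<and>
     (\<exists>c. distinct c \<and> set c = {1..n} \<and> (\<forall>i<n. {c ! i, c ! (Suc i mod n)} \<in># G))"

lemma HAM_increasing: "HAM n G \<Longrightarrow> G \<subseteq># H \<Longrightarrow> HAM n H"
  unfolding HAM_def by (meson mset_subset_eqD)

definition f_HAM :: "real \<Rightarrow> real" where
  "f_HAM s = 2 + exp (-3 * s) * (s + 1) * (1 - s^2/2 - s^3/3 - s^4/8)
           + exp (-2 * s) * (2 * s + 5 * s^2/2 + s^3/2) - exp (-s) * (3 + 2 * s)"

lemma f_HAM_deriv_pos:
  assumes "0 \<le> s"
  shows "\<exists>d. (f_HAM has_real_derivative d) (at s) \<and> d > 0"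
proof -
  let ?z = "exp (-s)" and ?y = "exp s"
  let ?A = "- 2 - 4 * s - s^2 + 2/3 * s^3 + 3/4 * s^4 + 3/8 * s^5"
  let ?B = "2 + s - 7/2 * s^2 - s^3"
  have zy: "?z * ?y = 1" by (simp flip: exp_add)
  have d: "(f_HAM has_real_derivative (exp (-3 * s) * ?A + exp (-2 * s) * ?B + ?z * (1 + 2 * s))) (at s)"
    unfolding f_HAM_def[abs_def]
    by (rule derivative_eq_intros refl | simp)+
       (simp add: algebra_simps power2_eq_square power3_eq_cube power4_eq_xxxx eval_nat_numeral)
  have e: "exp (-3 * s) = ?z^3" "exp (-2 * s) = ?z^2"
    by (simp_all flip: exp_of_nat_mult)
  have eq: "exp (-3 * s) * ?A + exp (-2 * s) * ?B + ?z * (1 + 2 * s)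
      = ?z^3 * (?A + ?y * (?B + ?y * (1 + 2 * s)))"
  proof -
    have "?z^3 * (?A + ?y * (?B + ?y * (1 + 2 * s)))
      = ?z^3 * ?A + ?z^2 * (?z * ?y) * ?B + ?z * (?z * ?y)^2 * (1 + 2 * s)"
      by (simp add: algebra_simps power2_eq_square power3_eq_cube)
    then show ?thesis unfolding e zy by simp
  qed
  have "(\<Sum>k<4. s^k / fact k) \<le> ?y"
    using exp_lower_Taylor_quadratic[OF assms] Maclaurin_exp_le[of s 4] assms by auto
  then have y3: "1 + s + s^2/2 + s^3/6 \<le> ?y"
    by (simp add: eval_nat_numeral)
  have "(1 + s + s^2/2 + s^3/6) * (1 + 2 * s) \<le> ?y * (1 + 2 * s)"
    by (rule mult_right_mono[OF y3]) (use assms in simp)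
  moreover have "(1 + s + s^2/2 + s^3/6) * (1 + 2 * s) + ?B = 3 + 4 * s - s^2 + s^3/6 + s^4/3"
    by (simp add: field_simps power2_eq_square power3_eq_cube power4_eq_xxxx)
  ultimately have br: "3 + 4 * s - s^2 + s^3/6 + s^4/3 \<le> ?B + ?y * (1 + 2 * s)"
    by linarith
  have br0: "0 \<le> 3 + 4 * s - s^2 + s^3/6 + s^4/3"
  proof -
    have "3 + 4 * s - s^2 + s^3/6 + s^4/3 = 2 + 4 * s + s^3/6 + (1 - s^2/2)^2 + (s^2)^2/12"
      by (simp add: algebra_simps power2_eq_square power3_eq_cube power4_eq_xxxx)
    also have "\<dots> \<ge> 0" using assms by (intro add_nonneg_nonneg) auto
    finally show ?thesis .
  qed
  have "1 * (?B + ?y * (1 + 2 * s)) \<le> ?y * (?B + ?y * (1 + 2 * s))"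
    by (rule mult_right_mono) (use assms br br0 in auto)
  from order.trans[OF br this[unfolded mult_1_left]]
  have "?A + (3 + 4 * s - s^2 + s^3/6 + s^4/3) \<le> ?A + ?y * (?B + ?y * (1 + 2 * s))"
    by (rule add_left_mono)
  moreover have "0 < ?A + (3 + 4 * s - s^2 + s^3/6 + s^4/3)"
  proof -
    have "?A + (3 + 4 * s - s^2 + s^3/6 + s^4/3)
        = (1 - s^2)^2 + (s^2)^2/12 + 5/6 * s^3 + 3/8 * s^5"
      by (simp add: algebra_simps power2_eq_square power3_eq_cube power4_eq_xxxx)
    also have "\<dots> > 0"
    proof (cases "s = 0")
      case False
      then show ?thesis using assms by (intro add_nonneg_pos) auto
    qed simp
    finally show ?thesis .
  qed
  ultimately have "0 < ?z^3 * (?A + ?y * (?B + ?y * (1 + 2 * s)))"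
    by (intro mult_pos_pos) auto
  with d eq show ?thesis by metis
qed

lemma f_HAM_strict_mono: "0 \<le> a \<Longrightarrow> a < b \<Longrightarrow> f_HAM a < f_HAM b"
  by (rule DERIV_pos_imp_increasing) (auto intro: f_HAM_deriv_pos)

lemma exp_neg_bounds:
  fixes x :: real
  assumes "0 \<le> x" and "x \<le> 2"
  shows "exp (-x) \<le> 1 / (\<Sum>k<14. x ^ k / fact k)"
    and "(1 - x ^ 14 / fact 14) / (\<Sum>k<14. x ^ k / fact k) \<le> exp (-x)"
proof -
  let ?S = "\<Sum>k<14. x ^ k / fact k"
  have "1 \<le> ?S"
    using sum_mono2[of "{..<14}" "{0::nat}" "\<lambda>k. x ^ k / fact k"] assms by auto
  obtain t where t: "\<bar>t\<bar> \<le> \<bar>x\<bar>" "exp x = ?S + exp t / fact 14 * x ^ 14"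
    using Maclaurin_exp_le[of x 14] by blast
  have "exp t \<le> exp x" using t(1) assms by auto
  then have "exp t / fact 14 * x ^ 14 \<le> exp x / fact 14 * x ^ 14"
    using assms by (intro mult_right_mono divide_right_mono) auto
  with t have up: "exp x * (1 - x ^ 14 / fact 14) \<le> ?S"
    unfolding right_diff_distrib by simp
  have lo: "?S \<le> exp x" using t assms by auto
  show "exp (-x) \<le> 1 / ?S"
    using lo \<open>1 \<le> ?S\<close> by (simp add: exp_minus field_simps)
  show "(1 - x ^ 14 / fact 14) / ?S \<le> exp (-x)"
    using up \<open>1 \<le> ?S\<close> by (simp add: exp_minus field_simps)
qed

lemma exp_neg_numeric:
  "exp (-1.26575 :: real) \<in> {0.282027695 .. 0.282027697}"
  "exp (-1.26576 :: real) \<in> {0.282024875 .. 0.282024877}"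
  using exp_neg_bounds[of "1.26575"] exp_neg_bounds[of "1.26576"]
  by (simp_all add: lessThan_nat_numeral fact_numeral power_divide)

lemma f_HAM_numeric: "f_HAM 1.26575 < 1" "1 < f_HAM 1.26576"
proof -
  let ?P = "\<lambda>s::real. (s + 1) * (1 - s^2/2 - s^3/3 - s^4/8)"
  let ?Q = "\<lambda>s::real. 2 * s + 5 * s^2/2 + s^3/2"
  have f: "f_HAM s = 2 + exp (-s)^3 * ?P s + exp (-s)^2 * ?Q s - exp (-s) * (3 + 2 * s)" for s
    unfolding f_HAM_def by (simp flip: exp_of_nat_mult)
  define z w where "z = exp (-1.26575 :: real)" and "w = exp (-1.26576 :: real)"
  have z: "0.282027695 \<le> z" "z \<le> 0.282027697" and w: "0.282024875 \<le> w" "w \<le> 0.282024877"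
    using exp_neg_numeric by (auto simp: z_def w_def)
  have pw: "0.0224323759 \<le> z^3" "z^2 \<le> 0.0795396219" "w^3 \<le> 0.0224317035" "0.0795380301 \<le> w^2"
    using power_mono[OF z(1), of 3] power_mono[OF z(2), of 2]
      power_mono[OF w(2), of 3] power_mono[OF w(1), of 2] z(1) w(1)
    by (simp_all add: power_divide)
  have "f_HAM 1.26575 = 2 + z^3 * ?P 1.26575 + z^2 * ?Q 1.26575 - z * (3 + 2 * 1.26575)"
    unfolding f z_def ..
  also have "?P 1.26575 = (-14809353670409889543/8192000000000000000)" by (simp add: power_divide)
  also have "?Q 1.26575 = 966496165047/128000000000" by (simp add: power_divide)
  finally show "f_HAM 1.26575 < 1" using z pw(1,2) by simp
  have "f_HAM 1.26576 = 2 + w^3 * ?P 1.26576 + w^2 * ?Q 1.26576 - w * (3 + 2 * 1.26576)"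
    unfolding f w_def ..
  also have "?P 1.26576 = (-137930172922490686801/76293945312500000000)" by (simp add: power_divide)
  also have "?Q 1.26576 = 3686942680281/488281250000" by (simp add: power_divide)
  finally show "1 < f_HAM 1.26576" using w pw(3,4) by simp
qed

lemma f_HAM_root: "\<exists>!s. 0 < s \<and> f_HAM s - 1 = 0"
  and f_HAM_root_approx: "0 < s \<Longrightarrow> f_HAM s - 1 = 0 \<Longrightarrow> 1.26575 < s \<and> s < 1.26576"
proof -
  have "\<exists>s\<ge>1.26575. s \<le> 1.26576 \<and> f_HAM s = 1"
    using f_HAM_numeric
    by (intro IVT') (auto simp: f_HAM_def intro!: continuous_intros)
  then show "\<exists>!s. 0 < s \<and> f_HAM s - 1 = 0"
  proof (elim exE conjE, intro ex1I conjI)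
    fix s t :: real
    assume "1.26575 \<le> s" "f_HAM s = 1" "0 < t \<and> f_HAM t - 1 = 0"
    then show "t = s"
      using f_HAM_strict_mono[of s t] f_HAM_strict_mono[of t s] by (cases s t rule: linorder_cases) auto
  qed auto
next
  assume "0 < s" "f_HAM s - 1 = 0"
  then show "1.26575 < s \<and> s < 1.26576"
    using f_HAM_numeric f_HAM_strict_mono[of s "1.26575"] f_HAM_strict_mono[of "1.26576" s]
    by (cases "s = 1.26575"; cases "s = 1.26576"; force)
qed

end

theory Submission
  imports Defs
begin

text \<open>Call the random vertex \<open>u\<^sub>t\<close> of round \<open>t\<close> a square and the chosen vertex \<open>v\<^sub>t\<close> a circle. A
  Hamiltonian cycle consists of \<open>n\<close> rounds, at most two of them at each vertex. Call a round whose
  square lies on a vertex with at most two squares spoiled if its circle later receives at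
  least two squares, and unspoiled otherwise. A spoiled round on the cycle uses up capacity of a
  vertex that has at least two squares of its own, which gives
  \<open>n \<le> 2 H + U + C\<close>, where \<open>H\<close> is the number of vertices with at least three squares, \<open>U\<close> that of
  the unspoiled rounds and \<open>C\<close> that of the chains of two spoiled rounds, the circle of the first
  being the square of the second.

  No strategy can influence the future squares, so the expectations of \<open>H\<close>, \<open>U\<close> and \<open>C\<close> after
  \<open>s n\<close> rounds have asymptotic upper bounds that depend on \<open>s\<close> only. For \<open>s = 19/15 > \<beta>\<close> the
  resulting bound for \<open>(2 H + U + C) / n\<close> is a constant below \<open>1\<close>, and by Markov's inequality the
  probability of a Hamiltonian cycle stays away from \<open>1\<close>. Since \<open>C_const\<close> is a limit for
  \<open>q \<rightarrow> 1\<close> of a limes superior, this suffices, even along multiples of \<open>15\<close>.\<close>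

section \<open>Squares and circles of a Hamiltonian cycle\<close>

definition squares :: "(nat \<times> nat) list \<Rightarrow> nat \<Rightarrow> nat set" where
  "squares h z = {l. l < length h \<and> fst (h ! l) = z}"

text \<open>Squares of earlier rounds are left out because the strategy sees them when it chooses
  the circle of \<open>i\<close>. The later ones are independent of that choice.\<close>

definition later_squares :: "(nat \<times> nat) list \<Rightarrow> nat \<Rightarrow> nat set" where
  "later_squares h i = {l. i < l \<and> l < length h \<and> fst (h ! l) = snd (h ! i)}"

definition heavy :: "(nat \<times> nat) list \<Rightarrow> nat set" where
  "heavy h = {z. 3 \<le> card (squares h z)}"

definition spoiled :: "(nat \<times> nat) list \<Rightarrow> nat set" where
  "spoiled h = {i. i < length h \<and> card (squares h (fst (h ! i))) \<le> 2 \<and> 2 \<le> card (later_squares h i)}"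

definition unspoiled :: "(nat \<times> nat) list \<Rightarrow> nat set" where
  "unspoiled h = {i. i < length h \<and> card (squares h (fst (h ! i))) \<le> 2 \<and> card (later_squares h i) \<le> 1}"

text \<open>Pairs are counted rather than rounds: one spoiled square \<open>j\<close> may have to be
  charged once for every spoiled circle on the same vertex.\<close>

definition spoiled_chains :: "(nat \<times> nat) list \<Rightarrow> (nat \<times> nat) set" where
  "spoiled_chains h = {(i, j). i \<in> spoiled h \<and> j \<in> spoiled h \<and> snd (h ! i) = fst (h ! j)}"

definition valid_history :: "nat \<Rightarrow> (nat \<times> nat) list \<Rightarrow> bool" where
  "valid_history n h \<longleftrightarrow> (\<forall>e\<in>set h. fst e \<in> {1..n} \<and> snd e \<in> {1..n} \<and> fst e \<noteq> snd e)"

lemma finite_squares [simp]: "finite (squares h z)"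
  and finite_later_squares [simp]: "finite (later_squares h i)"
  and finite_spoiled [simp]: "finite (spoiled h)"
  and finite_unspoiled [simp]: "finite (unspoiled h)"
  unfolding squares_def later_squares_def spoiled_def unspoiled_def
  by (rule finite_subset[of _ "{..<length h}"]; force)+

lemma finite_spoiled_chains [simp]: "finite (spoiled_chains h)"
  by (rule finite_subset[of _ "spoiled h \<times> spoiled h"]) (auto simp: spoiled_chains_def)

lemma heavy_subset: "heavy h \<subseteq> fst ` set h"
proof
  fix z assume "z \<in> heavy h"
  then have "squares h z \<noteq> {}" by (auto simp: heavy_def)
  then show "z \<in> fst ` set h" by (auto simp: squares_def)
qed

lemma card_eq_sum_fibres:
  assumes "finite X" "finite Y" "f ` X \<subseteq> Y"
  shows "card X = (\<Sum>y\<in>Y. card {x \<in> X. f x = y})"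
  using sum.group[OF assms, of "\<lambda>_. 1 :: nat"] by simp

text \<open>If \<open>q\<close> edges of \<open>A\<close> that are spoiled end in a vertex \<open>z\<close> with exactly two squares, then at
  least \<open>q\<close> squares of \<open>z\<close> are not used by \<open>A\<close>; each of these is unspoiled, or it is the second
  edge of a chain.\<close>

lemma spoiled_circles_le:
  assumes A: "A \<subseteq> {..<length h}"
    and deg: "card {t \<in> A. fst (h ! t) = z} + card {t \<in> A. snd (h ! t) = z} \<le> 2"
    and z: "z \<notin> heavy h"
  shows "card {t \<in> A \<inter> spoiled h. snd (h ! t) = z}
    \<le> card {j \<in> unspoiled h - A. fst (h ! j) = z} + card {c \<in> spoiled_chains h. snd (h ! fst c) = z}"
proof (cases "{t \<in> A \<inter> spoiled h. snd (h ! t) = z} = {}")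
  case False
  let ?G = "{t \<in> A \<inter> spoiled h. snd (h ! t) = z}"
  have fA: "finite A" using A finite_subset by blast
  from False obtain i where i: "i \<in> spoiled h" "snd (h ! i) = z" by auto
  have "later_squares h i \<subseteq> squares h z"
    using i by (auto simp: later_squares_def squares_def)
  then have "card (later_squares h i) \<le> card (squares h z)" by (intro card_mono) auto
  moreover have "2 \<le> card (later_squares h i)" using i by (auto simp: spoiled_def)
  moreover have "card (squares h z) \<le> 2" using z by (auto simp: heavy_def)
  ultimately have two: "card (squares h z) = 2" by simp
  have inA: "squares h z \<inter> A = {t \<in> A. fst (h ! t) = z}"
    using A by (auto simp: squares_def)
  have "card ?G \<le> card {t \<in> A. snd (h ! t) = z}" using fA by (intro card_mono) auto
  moreover have "card (squares h z - A) = card (squares h z) - card (squares h z \<inter> A)"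
    by (simp add: card_Diff_subset_Int)
  ultimately have q: "card ?G \<le> card (squares h z - A)"
    unfolding inA two using deg by linarith
  show ?thesis
  proof (cases "\<exists>j\<in>squares h z - A. j \<in> spoiled h")
    case True
    then obtain j where j: "j \<in> squares h z" "j \<in> spoiled h" by auto
    have "card ?G = card ((\<lambda>i. (i, j)) ` ?G)" by (simp add: card_image inj_on_def)
    also have "\<dots> \<le> card {c \<in> spoiled_chains h. snd (h ! fst c) = z}"
    proof (rule card_mono)
      show "(\<lambda>i. (i, j)) ` ?G \<subseteq> {c \<in> spoiled_chains h. snd (h ! fst c) = z}"
        using j by (auto simp: spoiled_chains_def squares_def)
    qed simp
    finally show ?thesis by simp
  next
    case False
    then have "squares h z - A \<subseteq> {j \<in> unspoiled h - A. fst (h ! j) = z}"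
      using two by (fastforce simp: squares_def spoiled_def unspoiled_def)
    then have "card (squares h z - A) \<le> card {j \<in> unspoiled h - A. fst (h ! j) = z}"
      by (intro card_mono) auto
    with q show ?thesis by simp
  qed
next
  case True
  show ?thesis unfolding True by simp
qed

text \<open>\<open>A\<close> splits into rounds with heavy square, unspoiled rounds and spoiled
  rounds. The degree bound two at a heavy vertex pays for its squares and for the spoiled circles on
  it. Spoiled circles elsewhere are paid by chains and by unspoiled rounds outside \<open>A\<close>,
  which together with those inside \<open>A\<close> make up \<open>unspoiled h\<close>.\<close>

lemma two_matching_card_le:
  assumes A: "A \<subseteq> {..<length h}"
    and deg: "\<And>z. card {t \<in> A. fst (h ! t) = z} + card {t \<in> A. snd (h ! t) = z} \<le> 2"
  shows "card A \<le> 2 * card (heavy h) + card (unspoiled h) + card (spoiled_chains h)"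
proof -
  define V where "V = fst ` set h \<union> snd ` set h"
  define P where "P = {t \<in> A. fst (h ! t) \<in> heavy h}"
  define G where "G = A \<inter> spoiled h"
  have fin: "finite V" "finite A" "finite P" "finite G" "finite (heavy h)"
    using finite_subset[OF A] finite_subset[OF heavy_subset] by (auto simp: V_def P_def G_def)
  have hV: "heavy h \<subseteq> V" using heavy_subset by (auto simp: V_def)
  have inV: "fst (h ! t) \<in> V" "snd (h ! t) \<in> V" if "t < length h" for t
    using that by (auto simp: V_def)
  have "A \<subseteq> P \<union> (unspoiled h \<inter> A) \<union> G"
    using A by (force simp: P_def G_def heavy_def unspoiled_def spoiled_def)
  then have "card A \<le> card (P \<union> (unspoiled h \<inter> A) \<union> G)"
    using fin by (intro card_mono) auto
  also have "\<dots> \<le> card P + card (unspoiled h \<inter> A) + card G"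
    by (meson card_Un_le add_le_mono le_refl le_trans)
  finally have 1: "card A \<le> card P + card (unspoiled h \<inter> A) + card G" .
  have P: "card P = (\<Sum>z\<in>heavy h. card {t \<in> P. fst (h ! t) = z})"
    using fin by (intro card_eq_sum_fibres) (auto simp: P_def)
  have "card G = (\<Sum>z\<in>V. card {t \<in> G. snd (h ! t) = z})"
    using fin inV A by (intro card_eq_sum_fibres) (auto simp: G_def)
  also have "\<dots> = (\<Sum>z\<in>heavy h. card {t \<in> G. snd (h ! t) = z}) + (\<Sum>z\<in>V - heavy h. card {t \<in> G. snd (h ! t) = z})"
    using sum.subset_diff[OF hV fin(1)] by (simp add: add.commute)
  finally have 2: "card G = \<dots>" .
  have "(\<Sum>z\<in>heavy h. card {t \<in> P. fst (h ! t) = z}) + (\<Sum>z\<in>heavy h. card {t \<in> G. snd (h ! t) = z})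
      \<le> (\<Sum>z\<in>heavy h. 2)"
    unfolding sum.distrib[symmetric]
  proof (rule sum_mono)
    fix z
    have "card {t \<in> P. fst (h ! t) = z} \<le> card {t \<in> A. fst (h ! t) = z}"
      "card {t \<in> G. snd (h ! t) = z} \<le> card {t \<in> A. snd (h ! t) = z}"
      using fin by (auto simp: P_def G_def intro!: card_mono)
    with deg[of z] show "card {t \<in> P. fst (h ! t) = z} + card {t \<in> G. snd (h ! t) = z} \<le> 2"
      by linarith
  qed
  then have 3: "(\<Sum>z\<in>heavy h. card {t \<in> P. fst (h ! t) = z}) + (\<Sum>z\<in>heavy h. card {t \<in> G. snd (h ! t) = z})
      \<le> 2 * card (heavy h)" by simp
  have "(\<Sum>z\<in>V - heavy h. card {t \<in> G. snd (h ! t) = z})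
      \<le> (\<Sum>z\<in>V - heavy h. card {j \<in> unspoiled h - A. fst (h ! j) = z} + card {c \<in> spoiled_chains h. snd (h ! fst c) = z})"
    unfolding G_def by (intro sum_mono spoiled_circles_le[OF A deg]) auto
  also have "\<dots> \<le> (\<Sum>z\<in>V. card {j \<in> unspoiled h - A. fst (h ! j) = z} + card {c \<in> spoiled_chains h. snd (h ! fst c) = z})"
    using fin by (intro sum_mono2) auto
  also have "\<dots> = (\<Sum>z\<in>V. card {j \<in> unspoiled h - A. fst (h ! j) = z})
      + (\<Sum>z\<in>V. card {c \<in> spoiled_chains h. snd (h ! fst c) = z})"
    by (rule sum.distrib)
  also have "(\<Sum>z\<in>V. card {j \<in> unspoiled h - A. fst (h ! j) = z}) = card (unspoiled h - A)"
    using fin inV by (intro card_eq_sum_fibres[symmetric]) (auto simp: unspoiled_def)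
  also have "(\<Sum>z\<in>V. card {c \<in> spoiled_chains h. snd (h ! fst c) = z}) = card (spoiled_chains h)"
  proof (rule card_eq_sum_fibres[symmetric])
    show "(\<lambda>c. snd (h ! fst c)) ` spoiled_chains h \<subseteq> V" using inV by (auto simp: spoiled_chains_def spoiled_def)
  qed (use fin in auto)
  finally have 4: "(\<Sum>z\<in>V - heavy h. card {t \<in> G. snd (h ! t) = z}) \<le> card (unspoiled h - A) + card (spoiled_chains h)" .
  have "card (unspoiled h) = card (unspoiled h \<inter> A) + card (unspoiled h - A)"
    by (simp add: card_Diff_subset_Int card_mono)
  with 1 2 3 4 P show ?thesis by linarith
qed

text \<open>Two indices with the same edge agree or are successors of each other modulo
  \<open>n\<close>; the latter is impossible for \<open>n \<ge> 3\<close>.\<close>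

lemma cyclic_edges_inj:
  assumes n: "3 \<le> n" and c: "distinct c" "length c = n"
  shows "inj_on (\<lambda>i. {c ! i, c ! (Suc i mod n)}) {..<n}"
proof (rule inj_onI)
  fix i j assume ij: "i \<in> {..<n}" "j \<in> {..<n}"
    and eq: "{c ! i, c ! (Suc i mod n)} = {c ! j, c ! (Suc j mod n)}"
  have idx: "c ! k = c ! l \<longleftrightarrow> k = l" if "k < n" "l < n" for k l
    using that c by (simp add: nth_eq_iff_index_eq)
  have "Suc i mod n < n" "Suc j mod n < n" using n by auto
  with eq ij have "i = j \<or> (i = Suc j mod n \<and> Suc i mod n = j)"
    by (auto simp: doubleton_eq_iff idx)
  then show "i = j"
    using ij n by (auto simp: mod_Suc split: if_splits)
qed

text \<open>One round is selected for each edge of the cycle. As no round is a loop, the two counts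
  at \<open>z\<close> concern disjoint sets of rounds, and these come from the at most two cycle
  edges at \<open>z\<close>.\<close>

lemma HAM_imp_two_matching:
  assumes "HAM n (mset (map (\<lambda>(u, v). {u, v}) h))" and val: "valid_history n h"
  obtains A where "A \<subseteq> {..<length h}" "card A = n"
    "\<And>z. card {t \<in> A. fst (h ! t) = z} + card {t \<in> A. snd (h ! t) = z} \<le> 2"
proof -
  let ?e = "\<lambda>t. {fst (h ! t), snd (h ! t)}"
  from assms obtain c where n: "3 \<le> n" and c: "distinct c" "set c = {1..n}"
    and edges: "\<forall>i<n. {c ! i, c ! (Suc i mod n)} \<in># mset (map (\<lambda>(u, v). {u, v}) h)"
    unfolding HAM_def by auto
  let ?c = "\<lambda>i. {c ! i, c ! (Suc i mod n)}"
  have len: "length c = n" using c distinct_card[of c] by simp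
  have "\<exists>t<length h. ?e t = ?c i" if "i < n" for i
  proof -
    from edges that have "?c i \<in> (\<lambda>(u, v). {u, v}) ` set h" by simp
    then show ?thesis by (force simp: in_set_conv_nth)
  qed
  then obtain t where t: "\<And>i. i < n \<Longrightarrow> t i < length h \<and> ?e (t i) = ?c i" by metis
  have inj: "inj_on t {..<n}"
    using cyclic_edges_inj[OF n c(1) len] t by (smt (verit) inj_on_def lessThan_iff)
  define A where "A = t ` {..<n}"
  show thesis
  proof
    show "A \<subseteq> {..<length h}" using t by (auto simp: A_def)
    show "card A = n" using inj by (simp add: A_def card_image)
    fix z
    have ne: "fst (h ! k) \<noteq> snd (h ! k)" if "k \<in> A" for k
    proof -
      have "k < length h" using that t by (auto simp: A_def)
      then show ?thesis
        using val nth_mem[of k h] by (auto simp: valid_history_def)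
    qed
    have "card {k \<in> A. fst (h ! k) = z} + card {k \<in> A. snd (h ! k) = z}
        = card ({k \<in> A. fst (h ! k) = z} \<union> {k \<in> A. snd (h ! k) = z})"
    proof (rule card_Un_disjoint[symmetric])
      show "{k \<in> A. fst (h ! k) = z} \<inter> {k \<in> A. snd (h ! k) = z} = {}"
        by (rule equals0I) (metis (mono_tags, lifting) IntE mem_Collect_eq ne)
    qed (auto simp: A_def)
    also have "\<dots> \<le> card (t ` ({i. i < n \<and> c ! i = z} \<union> {i. i < n \<and> c ! (Suc i mod n) = z}))"
    proof (rule card_mono)
      show "{k \<in> A. fst (h ! k) = z} \<union> {k \<in> A. snd (h ! k) = z}
        \<subseteq> t ` ({i. i < n \<and> c ! i = z} \<union> {i. i < n \<and> c ! (Suc i mod n) = z})"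
      proof
        fix k assume "k \<in> {k \<in> A. fst (h ! k) = z} \<union> {k \<in> A. snd (h ! k) = z}"
        then obtain i where i: "i < n" "k = t i" "z \<in> ?e (t i)" by (auto simp: A_def)
        with t[OF i(1)] have "z \<in> ?c i" by simp
        with i show "k \<in> t ` ({i. i < n \<and> c ! i = z} \<union> {i. i < n \<and> c ! (Suc i mod n) = z})" by auto
      qed
    qed auto
    also have "\<dots> \<le> card ({i. i < n \<and> c ! i = z} \<union> {i. i < n \<and> c ! (Suc i mod n) = z})"
      by (intro card_image_le) auto
    also have "\<dots> \<le> card {i. i < n \<and> c ! i = z} + card {i. i < n \<and> c ! (Suc i mod n) = z}"
      by (rule card_Un_le)
    also have "\<dots> \<le> 1 + 1"
    proof (intro add_mono)
      show "card {i. i < n \<and> c ! i = z} \<le> 1"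
        using c len by (auto simp: card_le_Suc0_iff_eq nth_eq_iff_index_eq)
      have "i = j" if ij: "i < n" "j < n" and "c ! (Suc i mod n) = c ! (Suc j mod n)" for i j
      proof -
        have "Suc i mod n = Suc j mod n"
          using that n c len by (subst (asm) nth_eq_iff_index_eq) auto
        with ij show ?thesis by (auto simp: mod_Suc split: if_splits)
      qed
      then show "card {i. i < n \<and> c ! (Suc i mod n) = z} \<le> 1"
        by (auto simp: card_le_Suc0_iff_eq)
    qed
    finally show "card {k \<in> A. fst (h ! k) = z} + card {k \<in> A. snd (h ! k) = z} \<le> 2" by simp
  qed
qed

lemma HAM_imp_le:
  assumes "HAM n (mset (map (\<lambda>(u, v). {u, v}) h))" and "valid_history n h"
  shows "n \<le> 2 * card (heavy h) + card (unspoiled h) + card (spoiled_chains h)"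
proof -
  obtain A where "A \<subseteq> {..<length h}" "card A = n"
    "\<And>z. card {t \<in> A. fst (h ! t) = z} + card {t \<in> A. snd (h ! t) = z} \<le> 2"
    using HAM_imp_two_matching[OF assms] by blast
  then show ?thesis using two_matching_card_le[of A h] by blast
qed

section \<open>Adaptive patterns of squares\<close>

text \<open>An adaptive pattern: the set allowed for the next square may depend on the history,
  because patterns refer to circles that the strategy picks along the way.\<close>

definition follows :: "((nat \<times> nat) list \<Rightarrow> nat set) \<Rightarrow> (nat \<times> nat) list \<Rightarrow> bool" where
  "follows B h \<longleftrightarrow> (\<forall>l<length h. fst (h ! l) \<in> B (take l h))"

lemma valid_history_snoc [simp]:
  "valid_history n (h @ [(u, v)]) \<longleftrightarrow> valid_history n h \<and> u \<in> {1..n} \<and> v \<in> {1..n} \<and> u \<noteq> v"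
  by (auto simp: valid_history_def)

lemma follows_snoc [simp]: "follows B (h @ [(u, v)]) \<longleftrightarrow> follows B h \<and> u \<in> B h"
  by (auto simp: follows_def nth_append less_Suc_eq all_conj_distrib)

lemma set_pmf_history:
  assumes "n > 0" "is_strategy n S" "h \<in> set_pmf (history n S t)"
  shows "length h = t" "valid_history n h"
proof -
  have "length h = t \<and> valid_history n h"
    using assms(3)
  proof (induction t arbitrary: h)
    case 0
    then show ?case by (auto simp: valid_history_def)
  next
    case (Suc t)
    then show ?case using assms(1,2) by (fastforce simp: is_strategy_def)
  qed
  then show "length h = t" "valid_history n h" by auto
qed

text \<open>Given the history, the next square is uniform, so it lands in \<open>B h\<close> with
  probability at most \<open>b (length h)\<close>. Since this bound depends on the length alone, the
  factors multiply whatever the strategy does.\<close>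

lemma prob_follows_le:
  assumes n: "n > 0" and S: "is_strategy n S" and b: "\<And>l. l < T \<Longrightarrow> 0 \<le> b l"
    and card: "\<And>h. valid_history n h \<Longrightarrow> length h < T \<Longrightarrow> follows B h \<Longrightarrow>
       real (card (B h \<inter> {1..n})) \<le> real n * b (length h)"
  shows "measure_pmf.prob (history n S T) {h. follows B h} \<le> (\<Prod>l<T. b l)"
  using b card
proof (induction T)
  case 0
  then show ?case by simp
next
  case (Suc T)
  let ?F = "{h. follows B h}"
  let ?step = "\<lambda>h. bind_pmf (pmf_of_set {1..n}) (\<lambda>u. bind_pmf (S h u) (\<lambda>v. return_pmf (h @ [(u, v)])))"
  have step: "emeasure (?step h) ?F \<le> ennreal (b T) * indicator ?F h"
    if h: "h \<in> set_pmf (history n S T)" for h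
  proof -
    note h' = set_pmf_history[OF n S h]
    \<comment> \<open>The pattern constrains squares only, so the circle drawn after
      \<open>u\<close> does not affect the event.\<close>
    have ind: "emeasure (measure_pmf (bind_pmf (S h u) (\<lambda>v. return_pmf (h @ [(u, v)])))) ?F
        = indicator ?F h * indicator (B h) u" for u
    proof -
      have "indicator ?F (h @ [(u, v)]) = (indicator ?F h * indicator (B h) u :: ennreal)" for v
        by (simp add: indicator_def)
      then show ?thesis by (simp add: emeasure_bind_pmf)
    qed
    have "emeasure (?step h) ?F = (\<integral>\<^sup>+u. indicator ?F h * indicator (B h) u \<partial>measure_pmf (pmf_of_set {1..n}))"
      unfolding emeasure_bind_pmf[of "pmf_of_set {1..n}"] ind ..
    also have "\<dots> = indicator ?F h * (\<integral>\<^sup>+u. indicator (B h) u \<partial>measure_pmf (pmf_of_set {1..n}))"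
      by (rule nn_integral_cmult) simp
    also have "(\<integral>\<^sup>+u. indicator (B h) u \<partial>measure_pmf (pmf_of_set {1..n})) = ennreal (card (B h \<inter> {1..n}) / n)"
      using n by (simp add: emeasure_pmf_of_set Int_commute)
    also have "indicator ?F h * \<dots> \<le> indicator ?F h * ennreal (b T)"
    proof (cases "follows B h")
      case True
      then have "card (B h \<inter> {1..n}) / n \<le> b T"
        using Suc.prems(2)[of h] h' n by (simp add: field_simps)
      then show ?thesis using True by (simp add: ennreal_leI)
    qed simp
    finally show ?thesis by (simp add: mult.commute)
  qed
  have "ennreal (measure_pmf.prob (history n S (Suc T)) ?F) = emeasure (history n S (Suc T)) ?F"
    by (simp add: measure_pmf.emeasure_eq_measure)
  also have "\<dots> = (\<integral>\<^sup>+h. emeasure (?step h) ?F \<partial>history n S T)"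
    by (simp add: emeasure_bind_pmf)
  also have "\<dots> \<le> (\<integral>\<^sup>+h. ennreal (b T) * indicator ?F h \<partial>history n S T)"
    using step by (intro nn_integral_mono_AE) (simp add: AE_measure_pmf_iff)
  also have "\<dots> = ennreal (b T) * emeasure (history n S T) ?F"
    by (simp add: nn_integral_cmult)
  also have "\<dots> = ennreal (b T * measure_pmf.prob (history n S T) ?F)"
    using Suc.prems(1)[of T] by (simp add: measure_pmf.emeasure_eq_measure ennreal_mult)
  finally have "measure_pmf.prob (history n S (Suc T)) ?F \<le> b T * measure_pmf.prob (history n S T) ?F"
    using Suc.prems(1)[of T] by (subst (asm) ennreal_le_iff) auto
  also have "\<dots> \<le> b T * (\<Prod>l<T. b l)"
    using Suc by (intro mult_left_mono Suc.IH) auto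
  finally show ?case by (simp add: mult.commute)
qed

lemma finite_set_pmf_history:
  assumes "n > 0" "is_strategy n S"
  shows "finite (set_pmf (history n S T))"
proof (rule finite_subset)
  show "set_pmf (history n S T) \<subseteq> {h. set h \<subseteq> {1..n} \<times> {1..n} \<and> length h = T}"
    using set_pmf_history[OF assms] by (fastforce simp: valid_history_def)
  show "finite {h. set h \<subseteq> {1..n} \<times> {1..n} \<and> length h = T}"
    by (intro finite_lists_length_eq) auto
qed

text \<open>First moment bound: \<open>Q i h\<close> certifies the element \<open>g i\<close>, so
  \<open>card (f h)\<close> is at most the number of certificates that hold. Several of them may
  yield the same element.\<close>

lemma expectation_card_le:
  assumes "n > 0" "is_strategy n S" "finite I"
    and sub: "\<And>h. valid_history n h \<Longrightarrow> length h = T \<Longrightarrow> f h \<subseteq> g ` {i \<in> I. Q i h}"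
  shows "measure_pmf.expectation (history n S T) (\<lambda>h. real (card (f h)))
    \<le> (\<Sum>i\<in>I. measure_pmf.prob (history n S T) {h. Q i h})"
proof -
  note [simp] = integrable_measure_pmf_finite[OF finite_set_pmf_history[OF assms(1,2)]]
  have "real (card (f h)) \<le> (\<Sum>i\<in>I. indicat_real {h. Q i h} h)"
    if "h \<in> set_pmf (history n S T)" for h
  proof -
    have "card (f h) \<le> card {i \<in> I. Q i h}"
      using surj_card_le[OF _ sub] set_pmf_history[OF assms(1,2) that] assms(3) by simp
    then show ?thesis using assms(3) by (simp add: indicator_def sum.If_cases Int_def)
  qed
  then have "measure_pmf.expectation (history n S T) (\<lambda>h. real (card (f h)))
    \<le> measure_pmf.expectation (history n S T) (\<lambda>h. \<Sum>i\<in>I. indicat_real {h. Q i h} h)"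
    by (intro integral_mono_AE) (auto simp: AE_measure_pmf_iff)
  then show ?thesis by (simp add: integrable_real_indicator less_top[symmetric])
qed

lemma sum_Sigma:
  assumes "finite A" "\<And>x. x \<in> A \<Longrightarrow> finite (B x)"
  shows "sum f (Sigma A B) = (\<Sum>x\<in>A. \<Sum>y\<in>B x. f (x, y))"
  using assms by (simp add: sum.Sigma)

lemma sum_subsets_by_card:
  fixes g :: "nat \<Rightarrow> real"
  assumes "finite X" "finite K"
  shows "(\<Sum>R | R \<subseteq> X \<and> card R \<in> K. g (card R)) = (\<Sum>j\<in>K. real (card X choose j) * g j)"
proof -
  have "(\<Sum>R | R \<subseteq> X \<and> card R \<in> K. g (card R))
      = (\<Sum>j\<in>K. \<Sum>R\<in>{R \<in> {R. R \<subseteq> X \<and> card R \<in> K}. card R = j}. g (card R))"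
    using assms by (intro sum.group[symmetric]) auto
  also have "\<dots> = (\<Sum>j\<in>K. real (card {R. R \<subseteq> X \<and> card R = j}) * g j)"
  proof (intro sum.cong refl)
    fix j assume "j \<in> K"
    then have "{R \<in> {R. R \<subseteq> X \<and> card R \<in> K}. card R = j} = {R. R \<subseteq> X \<and> card R = j}" by auto
    then show "(\<Sum>R\<in>{R \<in> {R. R \<subseteq> X \<and> card R \<in> K}. card R = j}. g (card R))
        = real (card {R. R \<subseteq> X \<and> card R = j}) * g j" by simp
  qed
  finally show ?thesis using assms by (simp add: n_subsets)
qed

section \<open>Binomial tails\<close>

definition binomial_term :: "real \<Rightarrow> nat \<Rightarrow> nat \<Rightarrow> real" where
  "binomial_term p T j = real (T choose j) * p ^ j * (1 - p) ^ (T - j)"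

text \<open>The probability of at least \<open>r\<close> successes, as a complement: the number of
  terms does not grow with \<open>T\<close>, so limits can be taken termwise.\<close>

definition binomial_tail :: "real \<Rightarrow> nat \<Rightarrow> nat \<Rightarrow> real" where
  "binomial_tail p T r = 1 - (\<Sum>j<r. binomial_term p T j)"

lemma sum_binomial_term: "(\<Sum>j=r..T. binomial_term p T j) = binomial_tail p T r"
proof -
  have "(\<Sum>j\<le>T. binomial_term p T j) = (p + (1 - p)) ^ T"
    unfolding binomial_ring binomial_term_def ..
  then have 1: "(\<Sum>j\<le>T. binomial_term p T j) = 1" by simp
  have "(\<Sum>j\<le>T. binomial_term p T j) = (\<Sum>j\<in>{..<r} \<inter> {..T}. binomial_term p T j) + (\<Sum>j=r..T. binomial_term p T j)"
    by (subst sum.union_disjoint[symmetric]) (auto intro!: sum.cong)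
  moreover have "(\<Sum>j\<in>{..<r} \<inter> {..T}. binomial_term p T j) = (\<Sum>j<r. binomial_term p T j)"
    by (intro sum.mono_neutral_left) (auto simp: binomial_term_def)
  ultimately show ?thesis using 1 by (simp add: binomial_tail_def)
qed

lemma binomial_term_Suc_Suc:
  "binomial_term p (Suc T) (Suc j) = p * binomial_term p T j + (1 - p) * binomial_term p T (Suc j)"
proof (cases "T \<ge> Suc j")
  case True
  then have "T - j = Suc (T - Suc j)" by simp
  then show ?thesis by (simp add: binomial_term_def algebra_simps)
next
  case False
  then have "T < Suc j" by simp
  then show ?thesis by (simp add: binomial_term_def binomial_eq_0)
qed

text \<open>Success number \<open>r + 1\<close> comes within the first \<open>T\<close> trials, or
  the last trial succeeds after exactly \<open>r\<close> successes.\<close>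

lemma binomial_tail_Suc:
  "binomial_tail p (Suc T) (Suc r) = binomial_tail p T (Suc r) + p * binomial_term p T r"
proof (induction r)
  case 0
  then show ?case by (simp add: binomial_tail_def binomial_term_def algebra_simps)
next
  case (Suc r)
  have "binomial_tail p (Suc T) (Suc (Suc r)) = binomial_tail p (Suc T) (Suc r) - binomial_term p (Suc T) (Suc r)"
    by (simp add: binomial_tail_def)
  also have "\<dots> = binomial_tail p T (Suc r) + p * binomial_term p T r - binomial_term p (Suc T) (Suc r)"
    by (simp add: Suc)
  also have "\<dots> = binomial_tail p T (Suc r) - (1 - p) * binomial_term p T (Suc r)"
    by (simp add: binomial_term_Suc_Suc)
  also have "\<dots> = binomial_tail p T (Suc (Suc r)) + p * binomial_term p T (Suc r)"
    by (simp add: binomial_tail_def algebra_simps)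
  finally show ?case .
qed

text \<open>Summation over the time of success number \<open>r + 1\<close>: it is trial
  \<open>m + 1\<close> if that trial succeeds after exactly \<open>r\<close> successes in
  \<open>m\<close> trials.\<close>

lemma sum_binomial_term_negative:
  "(\<Sum>m<T. p * binomial_term p m r) = binomial_tail p T (Suc r)"
proof (induction T)
  case 0
  have "(\<Sum>j<Suc r. binomial_term p 0 j) = (\<Sum>j\<in>{0::nat}. 1)"
    by (intro sum.mono_neutral_cong_right) (auto simp: binomial_term_def gr0_conv_Suc)
  then show ?case by (simp add: binomial_tail_def)
qed (simp add: binomial_tail_Suc)

section \<open>Expected numbers of heavy vertices, unspoiled rounds and chains\<close>

lemma valid_history_nth:
  assumes "valid_history n h" "l < length h"
  shows "fst (h ! l) \<in> {1..n}" "snd (h ! l) \<in> {1..n}" "fst (h ! l) \<noteq> snd (h ! l)"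
  using assms nth_mem[OF assms(2)] unfolding valid_history_def by blast+

lemma prod_before_at_after:
  fixes p x y :: real
  assumes "i < T"
  shows "(\<Prod>l<T. if l = i then p else if l < i then x else y) = p * x ^ i * y ^ (T - 1 - i)"
proof -
  let ?f = "\<lambda>l. if l = i then p else if l < i then x else y"
  have "{..<T} = {..<i} \<union> insert i {i<..<T}" using assms by auto
  then have "prod ?f {..<T} = prod ?f ({..<i} \<union> insert i {i<..<T})" by simp
  also have "\<dots> = prod ?f {..<i} * prod ?f (insert i {i<..<T})"
    by (rule prod.union_disjoint) auto
  also have "prod ?f (insert i {i<..<T}) = p * prod ?f {i<..<T}" by simp
  also have "prod ?f {..<i} = x ^ i" by simp
  also have "prod ?f {i<..<T} = (\<Prod>l\<in>{i<..<T}. y)" by (intro prod.cong) auto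
  finally show ?thesis by (simp add: mult_ac)
qed

lemma prod_power_card:
  fixes c :: real and T :: nat
  assumes "R \<subseteq> {..<T}"
  shows "(\<Prod>l<T. if l \<in> R then c else 1) = c ^ card R"
  using assms by (simp add: prod.If_cases Int_absorb1)

section \<open>Expectations after \<open>T\<close> rounds against a fixed strategy\<close>

context
  fixes n T :: nat and S :: strategy and p x a :: real
  assumes n: "n \<ge> 2" and S: "is_strategy n S"
  defines "p \<equiv> 1 / real n" and "x \<equiv> 1 - p" and "a \<equiv> p / x\<^sup>2"
begin

lemma p_pos: "p > 0" and x_pos: "x > 0" and n_p: "real n * p = 1" and n_x: "real n * x = real n - 1"
  and a_pos: "a > 0" and x_le_1: "x \<le> 1"
  using n by (auto simp: p_def x_def a_def field_simps)

lemma card_le_n_p: "A \<subseteq> {y} \<Longrightarrow> real (card A) \<le> real n * p"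
  using card_mono[of "{y}" A] unfolding n_p by simp

lemma card_le_n_x:
  assumes "A \<subseteq> {1..n} - {y}" "y \<in> {1..n}" shows "real (card A) \<le> real n * x"
  using card_mono[OF _ assms(1)] assms(2) n unfolding n_x by (simp add: of_nat_diff)

text \<open>Rounding \<open>1 - 2 * p\<close> up to \<open>x\<^sup>2\<close> turns every avoidance
  factor into a power of \<open>x\<close>, so that the later sums become binomial.\<close>

lemma card_le_n_x2:
  assumes "A \<subseteq> {1..n} - {y, z}" "y \<in> {1..n}" "z \<in> {1..n}" "y \<noteq> z" shows "real (card A) \<le> real n * x\<^sup>2"
proof -
  have "card A \<le> card ({1..n} - {y, z})" using assms(1) by (intro card_mono) auto
  also have "\<dots> = n - 2" using assms by (subst card_Diff_subset) auto
  finally have "real (card A) \<le> real n - 2" using n by simp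
  also have "\<dots> \<le> real n * x\<^sup>2" using n by (simp add: x_def p_def power2_eq_square field_simps)
  finally show ?thesis .
qed

text \<open>A certificate is a vertex \<open>z\<close> with the exact set \<open>R\<close> of its
  squares: \<open>z\<close> is hit in the rounds of \<open>R\<close> and avoided in all others,
  which gives binomial probabilities.\<close>

lemma expectation_heavy_le:
  "measure_pmf.expectation (history n S T) (\<lambda>h. real (card (heavy h))) \<le> real n * binomial_tail p T 3"
proof -
  define I where "I = {1..n} \<times> {R. R \<subseteq> {..<T} \<and> card R \<in> {3..T}}"
  define B where "B = (\<lambda>zR :: nat \<times> nat set. \<lambda>g::(nat \<times> nat) list. {w. w = fst zR \<longleftrightarrow> length g \<in> snd zR})"
  have fin: "finite I" by (simp add: I_def)
  have "measure_pmf.expectation (history n S T) (\<lambda>h. real (card (heavy h)))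
     \<le> (\<Sum>zR\<in>I. measure_pmf.prob (history n S T) {h. follows (B zR) h})"
  proof (rule expectation_card_le[OF _ S fin])
    fix h assume h: "valid_history n h" "length h = T"
    show "heavy h \<subseteq> fst ` {zR \<in> I. follows (B zR) h}"
    proof
      fix z assume z: "z \<in> heavy h"
      then have "z \<in> {1..n}" using heavy_subset h by (force simp: valid_history_def)
      moreover have "squares h z \<subseteq> {..<T}" using h by (auto simp: squares_def)
      moreover from this have "card (squares h z) \<le> T" using card_mono[of "{..<T}"] by auto
      moreover have "follows (B (z, squares h z)) h"
        by (auto simp: follows_def B_def squares_def)
      ultimately have "(z, squares h z) \<in> {zR \<in> I. follows (B zR) h}"
        using z by (auto simp: I_def heavy_def)
      then show "z \<in> fst ` {zR \<in> I. follows (B zR) h}" by force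
    qed
  qed (use n in simp)
  also have "\<dots> \<le> (\<Sum>zR\<in>I. p ^ card (snd zR) * x ^ (T - card (snd zR)))"
  proof (rule sum_mono)
    fix zR assume zR: "zR \<in> I"
    obtain z R where [simp]: "zR = (z, R)" by force
    have R: "R \<subseteq> {..<T}" and z: "z \<in> {1..n}" using zR by (auto simp: I_def)
    have "measure_pmf.prob (history n S T) {h. follows (B zR) h} \<le> (\<Prod>l<T. if l \<in> R then p else x)"
    proof (rule prob_follows_le[OF _ S])
      fix h :: "(nat \<times> nat) list"
      show "real (card (B zR h \<inter> {1..n})) \<le> real n * (if length h \<in> R then p else x)"
      proof (cases "length h \<in> R")
        case True
        then have "B zR h \<inter> {1..n} \<subseteq> {z}" by (auto simp: B_def)
        then show ?thesis using True card_le_n_p by simp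
      next
        case False
        then have "B zR h \<inter> {1..n} \<subseteq> {1..n} - {z}" by (auto simp: B_def)
        then show ?thesis using False card_le_n_x[OF _ z] by simp
      qed
    qed (use n p_pos x_pos in auto)
    also have "\<dots> = p ^ card (R) * x ^ (T - card R)"
      using R by (simp add: prod.If_cases Int_absorb1 Diff_eq[symmetric] card_Diff_subset finite_subset)
    finally show "measure_pmf.prob (history n S T) {h. follows (B zR) h} \<le> p ^ card (snd zR) * x ^ (T - card (snd zR))"
      by simp
  qed
  also have "\<dots> = real n * (\<Sum>R | R \<subseteq> {..<T} \<and> card R \<in> {3..T}. p ^ card R * x ^ (T - card R))"
    unfolding I_def by (simp add: sum_Sigma)
  also have "(\<Sum>R | R \<subseteq> {..<T} \<and> card R \<in> {3..T}. p ^ card R * x ^ (T - card R))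
      = (\<Sum>j=3..T. real (T choose j) * (p ^ j * x ^ (T - j)))"
    by (subst sum_subsets_by_card[where g = "\<lambda>j. p ^ j * x ^ (T - j)"]) auto
  also have "\<dots> = binomial_tail p T 3"
    unfolding sum_binomial_term[symmetric] binomial_term_def x_def by (simp add: mult.assoc)
  finally show ?thesis .
qed


text \<open>A square after round \<open>i\<close> avoids both ends of the edge of \<open>i\<close> with probability
  \<open>1 - 2 p \<le> x\<^sup>2\<close>; each exceptional round contributes the correction factor \<open>a = p / x\<^sup>2\<close>.\<close>

lemma expectation_unspoiled_le:
  "measure_pmf.expectation (history n S T) (\<lambda>h. real (card (unspoiled h)))
    \<le> real n * (x ^ (T - 1) * (1 + (real T - 1) * a) * (binomial_tail p T 1 + binomial_tail p T 2 / x))"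
proof -
  define small where "small = (\<lambda>X :: nat set. {L. L \<subseteq> X \<and> card L \<in> {0, 1}})"
  \<comment> \<open>A certificate for an unspoiled round \<open>i\<close>: the vertex
    \<open>z\<close> of its square, the other squares \<open>L\<close> on \<open>z\<close> and the
    later squares \<open>J\<close> on its circle, at most one each.\<close>
  define I where "I = (SIGMA i:{..<T}. {1..n} \<times> small ({..<T} - {i}) \<times> small {i<..<T})"
  define B where "B = (\<lambda>(i, z, L, J). \<lambda>g::(nat \<times> nat) list.
    {w. (w = z \<longleftrightarrow> length g = i \<or> length g \<in> L) \<and> (i < length g \<longrightarrow> (w = snd (g ! i) \<longleftrightarrow> length g \<in> J))})"
  have fin_small: "finite (small X)" if "finite X" for X using that by (simp add: small_def)
  then have fin: "finite I" by (auto simp: I_def)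
  have small_sum: "(\<Sum>L\<in>small X. a ^ card L) = 1 + real (card X) * a" if "finite X" for X
    unfolding small_def by (subst sum_subsets_by_card[OF that]) auto
  have "measure_pmf.expectation (history n S T) (\<lambda>h. real (card (unspoiled h)))
     \<le> (\<Sum>c\<in>I. measure_pmf.prob (history n S T) {h. follows (B c) h})"
  proof (rule expectation_card_le[OF _ S fin])
    fix h assume h: "valid_history n h" "length h = T"
    show "unspoiled h \<subseteq> fst ` {c \<in> I. follows (B c) h}"
    proof
      fix i assume i: "i \<in> unspoiled h"
      define z L where "z = fst (h ! i)" and "L = squares h z - {i}"
      from i have iT: "i < T" using h by (auto simp: unspoiled_def)
      then have "z \<in> {1..n}" using valid_history_nth[OF h(1)] h(2) by (simp add: z_def)
      moreover have "i \<in> squares h z" using iT h by (auto simp: squares_def z_def)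
      then have "card L \<le> 1" using i by (auto simp: L_def unspoiled_def z_def)
      then have "L \<in> small ({..<T} - {i})"
        using h by (auto simp: small_def L_def squares_def le_Suc_eq simp del: card_0_eq)
      moreover have "later_squares h i \<in> small {i<..<T}"
        using i h by (auto simp: small_def later_squares_def unspoiled_def le_Suc_eq simp del: card_0_eq)
      moreover have "follows (B (i, z, L, later_squares h i)) h"
        using iT h by (auto simp: follows_def B_def L_def squares_def later_squares_def z_def)
      ultimately have "(i, z, L, later_squares h i) \<in> {c \<in> I. follows (B c) h}"
        using iT by (auto simp: I_def)
      then show "i \<in> fst ` {c \<in> I. follows (B c) h}" by force
    qed
  qed (use n in simp)
  also have "\<dots> \<le> (\<Sum>(i, z, L, J)\<in>I. p * x ^ i * (x\<^sup>2) ^ (T - 1 - i) * (a ^ card L * a ^ card J))"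
  proof (rule sum_mono, clarify)
    fix i z L J assume c: "(i, z, L, J) \<in> I"
    then have i: "i < T" and z: "z \<in> {1..n}" and L: "L \<subseteq> {..<T}" "i \<notin> L" and J: "J \<subseteq> {i<..<T}"
      by (auto simp: I_def small_def)
    \<comment> \<open>Apart from exceptional rounds, only \<open>z\<close> is avoided before round
      \<open>i\<close>, and also the circle of \<open>i\<close> after it.\<close>
    let ?b = "\<lambda>l. (if l = i then p else if l < i then x else x\<^sup>2) * ((if l \<in> L then a else 1) * (if l \<in> J then a else 1))"
    have "measure_pmf.prob (history n S T) {h. follows (B (i, z, L, J)) h} \<le> (\<Prod>l<T. ?b l)"
    proof (rule prob_follows_le[OF _ S])
      fix h :: "(nat \<times> nat) list"
      assume h: "valid_history n h" "length h < T" "follows (B (i, z, L, J)) h"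
      let ?C = "B (i, z, L, J) h \<inter> {1..n}"
      consider "length h = i" | "length h < i" "length h \<in> L" | "length h < i" "length h \<notin> L" | "i < length h"
        by linarith
      then show "real (card ?C) \<le> real n * ?b (length h)"
      proof cases
        case 1
        then have "?C \<subseteq> {z}" by (auto simp: B_def)
        then show ?thesis using 1 L J card_le_n_p by auto
      next
        case 2
        then have "?C \<subseteq> {z}" by (auto simp: B_def)
        then have "real (card ?C) \<le> real n * p" by (rule card_le_n_p)
        \<comment> \<open>Before round \<open>i\<close> the exact correction would be
          \<open>p\<close>/\<open>x\<close>; the larger \<open>a\<close> lets one factor serve all
          rounds.\<close>
        also have "\<dots> \<le> real n * (x * a)"
          using p_pos x_pos x_le_1 by (intro mult_left_mono) (simp_all add: a_def power2_eq_square field_simps)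
        finally show ?thesis using 2 J by auto
      next
        case 3
        then have "?C \<subseteq> {1..n} - {z}" by (auto simp: B_def)
        then show ?thesis using 3 J card_le_n_x[OF _ z] by auto
      next
        case 4
        let ?v = "snd (h ! i)"
        have "fst (h ! i) = z" using 4 h(3) by (auto simp: follows_def B_def)
        then have v: "?v \<in> {1..n}" "z \<noteq> ?v" using valid_history_nth[OF h(1) 4] by auto
        have xa: "x\<^sup>2 * a = p" using x_pos by (simp add: a_def)
        consider "length h \<in> L" "length h \<in> J" | "length h \<in> L" "length h \<notin> J" | "length h \<notin> L" "length h \<in> J"
          | "length h \<notin> L" "length h \<notin> J" by blast
        then show ?thesis
        proof cases
          case 1
          \<comment> \<open>A square lies on one vertex only and the edge of \<open>i\<close> is no
            loop, so the pattern is contradictory here.\<close>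
          then have "?C = {}" using 4 v by (auto simp: B_def)
          then show ?thesis using p_pos x_pos a_pos by simp
        next
          case 2
          then have "?C \<subseteq> {z}" by (auto simp: B_def)
          then show ?thesis using 2 4 card_le_n_p xa by auto
        next
          case 3
          then have "?C \<subseteq> {?v}" using 4 by (auto simp: B_def)
          then show ?thesis using 3 4 card_le_n_p xa by auto
        next
          case c: 4
          then have "?C \<subseteq> {1..n} - {z, ?v}" using 4 by (auto simp: B_def)
          then show ?thesis using c 4 card_le_n_x2[OF _ z v] by auto
        qed
      qed
    qed (use n p_pos x_pos a_pos in auto)
    also have "\<dots> = p * x ^ i * (x\<^sup>2) ^ (T - 1 - i) * (a ^ card L * a ^ card J)"
      unfolding prod.distrib prod_before_at_after[OF i] using L J
      by (subst (1 2) prod_power_card) auto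
    finally show "measure_pmf.prob (history n S T) {h. follows (B (i, z, L, J)) h}
      \<le> p * x ^ i * (x\<^sup>2) ^ (T - 1 - i) * (a ^ card L * a ^ card J)" .
  qed
  also have "\<dots> = (\<Sum>i<T. \<Sum>z\<in>{1..n}. \<Sum>L\<in>small ({..<T} - {i}). \<Sum>J\<in>small {i<..<T}.
      p * x ^ i * (x\<^sup>2) ^ (T - 1 - i) * (a ^ card L * a ^ card J))"
    unfolding I_def using fin_small by (simp add: sum_Sigma)
  also have "\<dots> = (\<Sum>i<T. x ^ (T - 1) * (1 + (real T - 1) * a) * (x ^ (T - 1 - i) * (1 + real (T - 1 - i) * a)))"
  proof (rule sum.cong[OF refl])
    fix i assume "i \<in> {..<T}"
    then have i: "i < T" by simp
    have "(\<Sum>z\<in>{1..n}. \<Sum>L\<in>small ({..<T} - {i}). \<Sum>J\<in>small {i<..<T}.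
          p * x ^ i * (x\<^sup>2) ^ (T - 1 - i) * (a ^ card L * a ^ card J))
        = real n * p * x ^ i * (x\<^sup>2) ^ (T - 1 - i)
          * ((\<Sum>L\<in>small ({..<T} - {i}). a ^ card L) * (\<Sum>J\<in>small {i<..<T}. a ^ card J))"
      by (simp add: sum_product sum_distrib_left mult_ac)
    also have "\<dots> = (x ^ i * x ^ (T - 1 - i)) * x ^ (T - 1 - i) * ((1 + (real T - 1) * a) * (1 + real (T - 1 - i) * a))"
      using i by (simp add: n_p small_sum of_nat_diff power2_eq_square power_mult_distrib)
    also have "x ^ i * x ^ (T - 1 - i) = x ^ (T - 1)" using i by (simp flip: power_add)
    finally show "(\<Sum>z\<in>{1..n}. \<Sum>L\<in>small ({..<T} - {i}). \<Sum>J\<in>small {i<..<T}.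
          p * x ^ i * (x\<^sup>2) ^ (T - 1 - i) * (a ^ card L * a ^ card J))
        = x ^ (T - 1) * (1 + (real T - 1) * a) * (x ^ (T - 1 - i) * (1 + real (T - 1 - i) * a))"
      by (simp add: mult_ac)
  qed
  also have "\<dots> = x ^ (T - 1) * (1 + (real T - 1) * a) * (\<Sum>m<T. x ^ m * (1 + real m * a))"
    unfolding sum_distrib_left[symmetric]
    using sum.nat_diff_reindex[of "\<lambda>m. x ^ m * (1 + real m * a)" T] by simp
  \<comment> \<open>The summand stands for zero or one later square on the circle; the division by
    \<open>x\<close> comes from \<open>a\<close> containing \<open>x\<^sup>2\<close> where a
    binomial term loses a single \<open>x\<close>.\<close>
  also have "(\<Sum>m<T. x ^ m * (1 + real m * a)) = (\<Sum>m<T. binomial_term p m 0 + binomial_term p m 1 / x)"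
  proof (rule sum.cong[OF refl])
    fix m
    show "x ^ m * (1 + real m * a) = binomial_term p m 0 + binomial_term p m 1 / x"
      using x_pos by (cases m) (simp_all add: binomial_term_def a_def x_def[symmetric] field_simps power2_eq_square)
  qed
  \<comment> \<open>Inserting \<open>real n * p = 1\<close> supplies the success factor of the
    negative binomial sum.\<close>
  also have "\<dots> = real n * ((\<Sum>m<T. p * binomial_term p m 0) + (\<Sum>m<T. p * binomial_term p m 1) / x)"
    unfolding sum.distrib sum_distrib_left[symmetric] sum_divide_distrib[symmetric]
    using n_p by (simp add: distrib_left mult.assoc[symmetric])
  also have "\<dots> = real n * (binomial_tail p T 1 + binomial_tail p T 2 / x)"
    unfolding sum_binomial_term_negative by (simp add: numeral_2_eq_2)
  finally show ?thesis by (simp add: mult_ac)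
qed

lemma expectation_spoiled_chains_le:
  "measure_pmf.expectation (history n S T) (\<lambda>h. real (card (spoiled_chains h)))
    \<le> real n * (4 * binomial_tail p T 5)"
proof -
  \<comment> \<open>A chain \<open>(i, j)\<close> is encoded by \<open>i\<close>, by a set \<open>R\<close> of four later rounds, namely the only two
    squares \<open>j\<close> and \<open>k\<close> on the circle of \<open>i\<close> and two squares on the circle of \<open>j\<close>, and by \<open>k\<close>.\<close>
  define \<R> where "\<R> = (\<lambda>i. {R. R \<subseteq> {i<..<T} \<and> card R \<in> {4}})"
  define I where "I = (SIGMA i:{..<T}. SIGMA R:\<R> i. R)"
  \<comment> \<open>This recovers \<open>j\<close>: the two squares on its circle come after
    \<open>j\<close>, whereas \<open>k\<close> may precede or follow it.\<close>
  define second where "second = (\<lambda>(R::nat set) k. Min (R - {k}))"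
  \<comment> \<open>Rounds outside \<open>R\<close> after \<open>i\<close> have to avoid the circle
    of \<open>i\<close> only: the circle of \<open>j\<close> may carry more later squares than the
    two selected.\<close>
  define B where "B = (\<lambda>(i, R, k). \<lambda>g::(nat \<times> nat) list.
    {w. i < length g \<longrightarrow> (w = snd (g ! i) \<longleftrightarrow> length g \<in> {second R k, k})
       \<and> (length g \<in> R - {second R k, k} \<longrightarrow> w = snd (g ! second R k))})"
  have fin\<R>: "finite (\<R> i)" "R \<in> \<R> i \<Longrightarrow> finite R" for i R
    by (auto simp: \<R>_def intro: finite_subset)
  then have fin: "finite I" by (auto simp: I_def intro!: finite_SigmaI)
  have "measure_pmf.expectation (history n S T) (\<lambda>h. real (card (spoiled_chains h)))
     \<le> (\<Sum>c\<in>I. measure_pmf.prob (history n S T) {h. follows (B c) h})"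
  proof (rule expectation_card_le[OF _ S fin])
    fix h assume h: "valid_history n h" "length h = T"
    show "spoiled_chains h \<subseteq> (\<lambda>(i, R, k). (i, second R k)) ` {c \<in> I. follows (B c) h}"
    proof clarify
      fix i j assume "(i, j) \<in> spoiled_chains h"
      then have ij: "i < T" "j < T" "2 \<le> card (later_squares h i)" "2 \<le> card (later_squares h j)"
        and z: "card (squares h (fst (h ! j))) \<le> 2" "snd (h ! i) = fst (h ! j)"
        using h by (auto simp: spoiled_chains_def spoiled_def)
      \<comment> \<open>At least two later squares among at most two squares: all squares of this
        vertex come after \<open>i\<close>, in particular \<open>j\<close>.\<close>
      have "later_squares h i \<subseteq> squares h (fst (h ! j))"
        using z by (auto simp: later_squares_def squares_def)
      then have eq: "later_squares h i = squares h (fst (h ! j))"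
        using z ij by (intro card_seteq) auto
      moreover have "j \<in> squares h (fst (h ! j))" using ij h by (simp add: squares_def)
      ultimately have j: "j \<in> later_squares h i" by simp
      have "card (later_squares h i - {j}) = 1" using ij z eq j by simp
      then obtain k where "later_squares h i - {j} = {k}" by (meson card_1_singletonE)
      then have jk: "later_squares h i = {j, k}" "k \<noteq> j" using j by auto
      obtain X where X: "X \<subseteq> later_squares h j" "card X = 2"
        using ij(4) by (metis obtain_subset_with_card_n)
      have fX: "finite X" using X finite_subset finite_later_squares by blast
      have X': "j < l \<and> l < T \<and> fst (h ! l) = snd (h ! j)" if "l \<in> X" for l
        using X that h by (auto simp: later_squares_def)
      have kk: "i < k" "k < T" "fst (h ! k) = fst (h ! j)" "i < j"
        using jk z h unfolding later_squares_def by auto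
      have ne: "fst (h ! j) \<noteq> snd (h ! j)" using valid_history_nth[OF h(1)] ij h by auto
      then have kX: "k \<notin> X" "j \<notin> X" using X' kk by force+
      have iX: "i < l" if "l \<in> X" for l using X'[OF that] kk by simp
      define R where "R = insert j (insert k X)"
      have R: "R \<in> \<R> i" "k \<in> R"
        using X' iX kk jk kX fX X(2) ij by (auto simp: R_def \<R>_def)
      have "R - {k} = insert j X" using kX jk by (auto simp: R_def)
      then have sec: "second R k = j"
        unfolding second_def using X' fX by (auto intro!: Min_eqI intro: less_imp_le)
      have mem: "fst (h ! l) = snd (h ! i) \<longleftrightarrow> l = j \<or> l = k" if "i < l" "l < T" for l
        using jk(1) that h by (auto simp: later_squares_def)
      have "l \<in> R \<longleftrightarrow> l = j \<or> l = k \<or> l \<in> X" for l by (auto simp: R_def)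
      then have "follows (B (i, R, k)) h"
        using h mem X' by (auto simp: follows_def B_def sec)
      then have "(i, R, k) \<in> {c \<in> I. follows (B c) h}" using R ij by (auto simp: I_def)
      moreover have "(i, j) = (\<lambda>(i, R, k). (i, second R k)) (i, R, k)" by (simp add: sec)
      ultimately show "(i, j) \<in> (\<lambda>(i, R, k). (i, second R k)) ` {c \<in> I. follows (B c) h}"
        by (rule rev_image_eqI)
    qed
  qed (use n in simp)
  also have "\<dots> \<le> (\<Sum>(i, R, k)\<in>I. p ^ 4 * x ^ (T - 1 - i - 4))"
  proof (rule sum_mono, clarify)
    fix i R k assume c: "(i, R, k) \<in> I"
    then have i: "i < T" and R: "R \<subseteq> {i<..<T}" "card R = 4" and k: "k \<in> R"
      by (auto simp: I_def \<R>_def)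
    have fR: "finite R" using R finite_subset by blast
    have "R - {k} \<noteq> {}"
    proof
      assume "R - {k} = {}"
      then have "R \<subseteq> {k}" by auto
      then have "card R \<le> card {k}" by (intro card_mono) auto
      with R show False by simp
    qed
    then have sec: "second R k \<in> R" "\<And>l. l \<in> R - {second R k, k} \<Longrightarrow> second R k < l"
      using fR Min_in[of "R - {k}"] Min_le[of "R - {k}"] unfolding second_def by (auto simp: le_less)
    let ?b = "\<lambda>l. if l \<in> R then p else if l \<in> {i<..<T} then x else 1"
    have "measure_pmf.prob (history n S T) {h. follows (B (i, R, k)) h} \<le> (\<Prod>l<T. ?b l)"
    proof (rule prob_follows_le[OF _ S])
      fix h :: "(nat \<times> nat) list"
      assume h: "valid_history n h" "length h < T"
      let ?C = "B (i, R, k) h \<inter> {1..n}"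
      consider "length h \<in> {second R k, k}" | "length h \<in> R - {second R k, k}" | "length h \<notin> R" "i < length h"
        | "length h \<notin> R" "length h \<le> i" by fastforce
      then show "real (card ?C) \<le> real n * ?b (length h)"
      proof cases
        case 1
        then have l: "length h \<in> R" using sec k by auto
        then have "?C \<subseteq> {snd (h ! i)}" using 1 R by (auto simp: B_def)
        then show ?thesis using l card_le_n_p by auto
      next
        case 2
        then have "?C \<subseteq> {snd (h ! second R k)}" using R by (auto simp: B_def)
        then show ?thesis using 2 card_le_n_p by auto
      next
        case 3
        then have "?C \<subseteq> {1..n} - {snd (h ! i)}" using sec k by (auto simp: B_def)
        then show ?thesis using 3 h card_le_n_x[OF _ valid_history_nth(2)[OF h(1)]] by auto
      next
        case 4
        have "card ?C \<le> card {1..n}" by (intro card_mono) auto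
        then show ?thesis using 4 by auto
      qed
    qed (use n p_pos x_pos in auto)
    also have "\<dots> = (\<Prod>l\<in>{i<..<T}. if l \<in> R then p else x)"
      using R i by (intro prod.mono_neutral_cong_right) auto
    also have "\<dots> = p ^ 4 * x ^ (T - 1 - i - 4)"
      using R fR by (simp add: prod.If_cases Int_absorb1 Diff_eq[symmetric] card_Diff_subset)
    finally show "measure_pmf.prob (history n S T) {h. follows (B (i, R, k)) h} \<le> p ^ 4 * x ^ (T - 1 - i - 4)" .
  qed
  also have "\<dots> = (\<Sum>i<T. \<Sum>R\<in>\<R> i. \<Sum>k\<in>R. p ^ 4 * x ^ (T - 1 - i - 4))"
    unfolding I_def using fin\<R> by (simp add: sum_Sigma sum_distrib_right)
  \<comment> \<open>The factor 4 counts the choices of \<open>k\<close> in \<open>R\<close>. The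
    rest is the probability of four successes in the \<open>T - 1 - i\<close> rounds after
    \<open>i\<close>.\<close>
  also have "\<dots> = (\<Sum>i<T. real (card (\<R> i)) * (4 * (p ^ 4 * x ^ (T - 1 - i - 4))))"
    by (intro sum.cong refl) (simp add: \<R>_def)
  also have "\<dots> = (\<Sum>i<T. 4 * binomial_term p (T - 1 - i) 4)"
    by (intro sum.cong refl) (simp add: \<R>_def n_subsets binomial_term_def x_def)
  also have "\<dots> = (\<Sum>m<T. 4 * binomial_term p m 4)"
    using sum.nat_diff_reindex[of "\<lambda>m. 4 * binomial_term p m 4" T] by simp
  also have "\<dots> = real n * (4 * (\<Sum>m<T. p * binomial_term p m 4))"
    using n_p by (simp add: sum_distrib_left[symmetric] mult.assoc[symmetric])
  also have "\<dots> = real n * (4 * binomial_tail p T 5)"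
    unfolding sum_binomial_term_negative by simp
  finally show ?thesis .
qed

text \<open>Markov's inequality: the deterministic bound holds pointwise on the event, and its
  expectation is divided by \<open>n\<close>.\<close>

lemma prob_HAM_le:
  "measure_pmf.prob (semi_random_graph n S T) {G. HAM n G}
    \<le> 2 * binomial_tail p T 3 + x ^ (T - 1) * (1 + (real T - 1) * a) * (binomial_tail p T 1 + binomial_tail p T 2 / x)
      + 4 * binomial_tail p T 5"
proof -
  note [simp] = integrable_measure_pmf_finite[OF finite_set_pmf_history[OF _ S]]
  let ?M = "history n S T"
  let ?H = "{h. HAM n (mset (map (\<lambda>(u, v). {u, v}) h))}"
  have n0: "n > 0" using n by simp
  have "real n * measure_pmf.prob (semi_random_graph n S T) {G. HAM n G} = real n * measure_pmf.prob ?M ?H"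
    unfolding semi_random_graph_def by (simp add: vimage_def)
  also have "\<dots> = measure_pmf.expectation ?M (\<lambda>h. real n * indicator ?H h)" by simp
  also have "\<dots> \<le> measure_pmf.expectation ?M (\<lambda>h. 2 * real (card (heavy h)) + real (card (unspoiled h)) + real (card (spoiled_chains h)))"
  proof (rule integral_mono_AE)
    have "real n * indicator ?H h \<le> 2 * real (card (heavy h)) + real (card (unspoiled h)) + real (card (spoiled_chains h))"
      if "h \<in> set_pmf ?M" for h
      using HAM_imp_le[OF _ set_pmf_history(2)[OF n0 S that]] by (auto simp: indicator_def)
    then show "AE h in ?M. real n * indicator ?H h
        \<le> 2 * real (card (heavy h)) + real (card (unspoiled h)) + real (card (spoiled_chains h))"
      by (simp add: AE_measure_pmf_iff)
  qed (use n0 in auto)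
  also have "\<dots> = 2 * measure_pmf.expectation ?M (\<lambda>h. real (card (heavy h)))
      + measure_pmf.expectation ?M (\<lambda>h. real (card (unspoiled h)))
      + measure_pmf.expectation ?M (\<lambda>h. real (card (spoiled_chains h)))"
    using n0 by simp
  also have "\<dots> \<le> 2 * (real n * binomial_tail p T 3)
      + real n * (x ^ (T - 1) * (1 + (real T - 1) * a) * (binomial_tail p T 1 + binomial_tail p T 2 / x))
      + real n * (4 * binomial_tail p T 5)"
    by (intro add_mono mult_left_mono expectation_heavy_le expectation_unspoiled_le expectation_spoiled_chains_le) auto
  also have "\<dots> = real n * (2 * binomial_tail p T 3
      + x ^ (T - 1) * (1 + (real T - 1) * a) * (binomial_tail p T 1 + binomial_tail p T 2 / x) + 4 * binomial_tail p T 5)"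
    by (simp add: algebra_simps)
  finally show ?thesis using n0 by simp
qed

end

section \<open>The limit\<close>

lemma prob_HAM_mono:
  assumes "t \<le> T"
  shows "measure_pmf.prob (semi_random_graph n S t) {G. HAM n G}
    \<le> measure_pmf.prob (semi_random_graph n S T) {G. HAM n G}"
  using assms
proof (rule lift_Suc_mono_le[rotated])
  fix t
  let ?H = "{h. HAM n (mset (map (\<lambda>(u, v). {u, v}) h))}"
  have snoc: "indicator ?H h \<le> (indicator ?H (h @ [(u, v)]) :: ennreal)" for h and u v :: nat
    using HAM_increasing[of n "mset (map (\<lambda>(u, v). {u, v}) h)"] by (auto simp: indicator_def)
  have "emeasure (history n S t) ?H = (\<integral>\<^sup>+h. \<integral>\<^sup>+u. \<integral>\<^sup>+v. indicator ?H h \<partial>S h u \<partial>pmf_of_set {1..n} \<partial>history n S t)"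
    by simp
  also have "\<dots> \<le> (\<integral>\<^sup>+h. \<integral>\<^sup>+u. \<integral>\<^sup>+v. indicator ?H (h @ [(u, v)]) \<partial>S h u \<partial>pmf_of_set {1..n} \<partial>history n S t)"
    by (intro nn_integral_mono snoc)
  also have "\<dots> = emeasure (history n S (Suc t)) ?H"
    by (simp add: emeasure_bind_pmf)
  finally show "measure_pmf.prob (semi_random_graph n S t) {G. HAM n G}
      \<le> measure_pmf.prob (semi_random_graph n S (Suc t)) {G. HAM n G}"
    unfolding semi_random_graph_def by (simp add: measure_pmf.emeasure_eq_measure vimage_def del: history.simps)
qed

text \<open>By monotonicity in time, a bound at the single time \<open>T\<close> excludes all
  earlier times.\<close>

lemma rounds_HAM_ge:
  assumes "\<And>S. is_strategy n S \<Longrightarrow> measure_pmf.prob (semi_random_graph n S T) {G. HAM n G} < q"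
  shows "enat T \<le> rounds HAM q n"
  unfolding rounds_def rounds_of_def
proof (intro INF_greatest; clarify)
  fix S t
  assume S: "is_strategy n S" and q: "q \<le> measure_pmf.prob (semi_random_graph n S t) {G. HAM n G}"
  show "enat T \<le> enat t"
  proof (rule ccontr)
    assume "\<not> enat T \<le> enat t"
    then have "measure_pmf.prob (semi_random_graph n S t) {G. HAM n G}
      \<le> measure_pmf.prob (semi_random_graph n S T) {G. HAM n G}"
      by (intro prob_HAM_mono) simp
    with assms[OF S] q show False by linarith
  qed
qed

text \<open>The ratio of consecutive terms drives the induction on \<open>j\<close> for the Poisson
  limit.\<close>

lemma binomial_term_Suc_right:
  assumes "j < T" "p < 1"
  shows "binomial_term p T (Suc j) = binomial_term p T j * ((real T - real j) * p) / (real (Suc j) * (1 - p))"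
proof -
  obtain T' where T: "T = Suc T'" using assms by (cases T) auto
  have "Suc j * (T choose Suc j) = (T - j) * (T choose j)"
    using Suc_times_binomial[of j T'] binomial_absorb_comp[of T j] unfolding T by simp
  then have c: "real (Suc j) * real (T choose Suc j) = (real T - real j) * real (T choose j)"
    using assms(1) by (metis of_nat_mult of_nat_diff less_imp_le)
  have e: "(1 - p) ^ (T - j) = (1 - p) ^ (T - Suc j) * (1 - p)"
    using assms(1) by (metis Suc_diff_Suc power_Suc2)
  have "binomial_term p T (Suc j) * (real (Suc j) * (1 - p))
      = (real (Suc j) * real (T choose Suc j)) * p ^ j * p * ((1 - p) ^ (T - Suc j) * (1 - p))"
    by (simp only: binomial_term_def power_Suc mult_ac)
  also have "\<dots> = binomial_term p T j * ((real T - real j) * p)"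
    unfolding c e[symmetric] by (simp only: binomial_term_def mult_ac)
  finally have "binomial_term p T (Suc j) * (real (Suc j) * (1 - p)) = binomial_term p T j * ((real T - real j) * p)" .
  moreover have "real (Suc j) * (1 - p) \<noteq> 0" using assms by simp
  ultimately show ?thesis by (metis nonzero_mult_div_cancel_right)
qed

section \<open>Poisson limits along \<open>n = b * k\<close> and \<open>T = a * k\<close>\<close>

context
  fixes a b :: nat and s :: real
  assumes ab: "a > 0" "b > 0"
  defines "s \<equiv> real a / real b"
begin

lemma b_k_gt_1:
  assumes "1 < k"
  shows "1 < b * k" "1 / real (b * k) < 1"
proof -
  have "1 * k \<le> b * k" using ab by (intro mult_right_mono) auto
  with assms show n: "1 < b * k" by linarith
  have "1 / r < 1" if "1 < r" for r :: real using that by simp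
  from this[of "real (b * k)"] show "1 / real (b * k) < 1"
    using n by (metis of_nat_1 of_nat_less_iff)
qed

lemma tendsto_p: "(\<lambda>k. 1 / real (b * k)) \<longlonglongrightarrow> 0"
  using tendsto_mult[OF tendsto_const lim_1_over_n, of "1 / real b"] by simp

lemma tendsto_x: "(\<lambda>k. 1 - 1 / real (b * k)) \<longlonglongrightarrow> 1"
  using tendsto_diff[OF tendsto_const tendsto_p, of 1] by simp

lemma tendsto_T_p: "(\<lambda>k. (real (a * k) - c) * (1 / real (b * k))) \<longlonglongrightarrow> s"
proof -
  have "(\<lambda>k. s - c * (1 / real (b * k))) \<longlonglongrightarrow> s - c * 0"
    by (intro tendsto_intros tendsto_p)
  moreover have "\<forall>\<^sub>F k in sequentially. s - c * (1 / real (b * k)) = (real (a * k) - c) * (1 / real (b * k))"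
    using eventually_gt_at_top[of 0] by eventually_elim (use ab in \<open>simp add: s_def field_simps\<close>)
  ultimately show ?thesis by (simp add: tendsto_cong)
qed

text \<open>With a rational \<open>s\<close> and \<open>n\<close> a multiple of \<open>b\<close>,
  this is the power \<open>a\<close> of the standard exponential limit; no rounding of
  \<open>s * n\<close> occurs.\<close>

lemma tendsto_x_power: "(\<lambda>k. (1 - 1 / real (b * k)) ^ (a * k)) \<longlonglongrightarrow> exp (- s)"
proof -
  have "(\<lambda>k. ((1 + (- 1 / real b) / real k) ^ k) ^ a) \<longlonglongrightarrow> exp (- 1 / real b) ^ a"
    by (intro tendsto_power tendsto_exp_limit_sequentially)
  moreover have "exp (- 1 / real b) ^ a = exp (- s)"
    by (simp add: s_def flip: exp_of_nat_mult)
  ultimately show ?thesis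
    by (simp add: power_mult[symmetric] mult.commute[of a])
qed

lemma tendsto_binomial_term:
  "(\<lambda>k. binomial_term (1 / real (b * k)) (a * k) j) \<longlonglongrightarrow> exp (- s) * s ^ j / fact j"
proof (induction j)
  case 0
  then show ?case using tendsto_x_power by (simp add: binomial_term_def)
next
  case (Suc j)
  have "(\<lambda>k. binomial_term (1 / real (b * k)) (a * k) j * ((real (a * k) - real j) * (1 / real (b * k)))
      / (real (Suc j) * (1 - 1 / real (b * k)))) \<longlonglongrightarrow> exp (- s) * s ^ j / fact j * s / (real (Suc j) * 1)"
    by (intro tendsto_intros Suc tendsto_T_p tendsto_x) auto
  also have "exp (- s) * s ^ j / fact j * s / (real (Suc j) * 1) = exp (- s) * s ^ Suc j / fact (Suc j)"
    by (simp add: field_simps)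
  finally show ?case
  proof (rule Lim_transform_eventually)
    show "\<forall>\<^sub>F k in sequentially. binomial_term (1 / real (b * k)) (a * k) j * ((real (a * k) - real j) * (1 / real (b * k)))
      / (real (Suc j) * (1 - 1 / real (b * k))) = binomial_term (1 / real (b * k)) (a * k) (Suc j)"
      using eventually_gt_at_top[of "j + 1"]
    proof eventually_elim
      case (elim k)
      have "1 * k \<le> a * k" using ab by (intro mult_right_mono) auto
      with elim have "j < a * k" by linarith
      then show ?case using b_k_gt_1(2)[of k] elim by (subst binomial_term_Suc_right) auto
    qed
  qed
qed

lemma tendsto_binomial_tail:
  "(\<lambda>k. binomial_tail (1 / real (b * k)) (a * k) r) \<longlonglongrightarrow> 1 - (\<Sum>j<r. exp (- s) * s ^ j / fact j)"
  unfolding binomial_tail_def by (intro tendsto_intros tendsto_binomial_term)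

lemma tendsto_prob_HAM_bound:
  "(\<lambda>k. let n = b * k; T = a * k; p = 1 / real n; x = 1 - p in
      2 * binomial_tail p T 3
      + x ^ (T - 1) * (1 + (real T - 1) * (p / x\<^sup>2)) * (binomial_tail p T 1 + binomial_tail p T 2 / x)
      + 4 * binomial_tail p T 5)
    \<longlonglongrightarrow> 2 * (1 - exp (- s) * (1 + s + s ^ 2 / 2))
      + exp (- s) * (1 + s) * (2 - exp (- s) * (2 + s))
      + 4 * (1 - exp (- s) * (1 + s + s ^ 2 / 2 + s ^ 3 / 6 + s ^ 4 / 24))"
    (is "?f \<longlonglongrightarrow> ?L")
proof -
  define p where "p = (\<lambda>k. 1 / real (b * k))"
  define T where "T = (\<lambda>k. a * k)"
  have x: "(\<lambda>k. 1 - p k) \<longlonglongrightarrow> 1" unfolding p_def by (rule tendsto_x)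
  have xT: "(\<lambda>k. (1 - p k) ^ T k) \<longlonglongrightarrow> exp (- s)" unfolding p_def T_def by (rule tendsto_x_power)
  have Tp: "(\<lambda>k. (real (T k) - 1) * p k) \<longlonglongrightarrow> s" unfolding p_def T_def by (rule tendsto_T_p)
  have tail: "(\<lambda>k. binomial_tail (p k) (T k) r) \<longlonglongrightarrow> 1 - (\<Sum>j<r. exp (- s) * s ^ j / fact j)" for r
    unfolding p_def T_def by (rule tendsto_binomial_tail)
  \<comment> \<open>The power with exponent \<open>T - 1\<close> is replaced by a quotient to which
    the limit for exponent \<open>T\<close> applies; both agree once \<open>k > 1\<close>.\<close>
  have "(\<lambda>k. 2 * binomial_tail (p k) (T k) 3
      + (1 - p k) ^ T k / (1 - p k) * (1 + (real (T k) - 1) * p k / (1 - p k)\<^sup>2)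
        * (binomial_tail (p k) (T k) 1 + binomial_tail (p k) (T k) 2 / (1 - p k))
      + 4 * binomial_tail (p k) (T k) 5)
    \<longlonglongrightarrow> 2 * (1 - (\<Sum>j<3. exp (- s) * s ^ j / fact j))
      + exp (- s) / 1 * (1 + s / 1\<^sup>2)
        * ((1 - (\<Sum>j<1. exp (- s) * s ^ j / fact j)) + (1 - (\<Sum>j<2. exp (- s) * s ^ j / fact j)) / 1)
      + 4 * (1 - (\<Sum>j<5. exp (- s) * s ^ j / fact j))" (is "?g \<longlonglongrightarrow> ?M")
    by (intro tendsto_intros tail x xT Tp) auto
  also have "?M = ?L"
    by (simp add: eval_nat_numeral lessThan_Suc algebra_simps add_divide_distrib)
  finally show ?thesis
  proof (rule Lim_transform_eventually)
    show "\<forall>\<^sub>F k in sequentially. ?g k = ?f k"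
      using eventually_gt_at_top[of 1]
    proof eventually_elim
      case (elim k)
      have "1 - p k \<noteq> 0" using b_k_gt_1(2)[OF elim] unfolding p_def by linarith
      moreover have "T k > 0" using ab elim by (simp add: T_def)
      ultimately have "(1 - p k) ^ T k / (1 - p k) = (1 - p k) ^ (T k - 1)"
        by (cases "T k") auto
      moreover have "1 / real (b * k) = p k" "a * k = T k" by (simp_all add: p_def T_def)
      ultimately show ?case by (simp only: Let_def) (simp only: times_divide_eq_right)
    qed
  qed
qed

text \<open>For \<open>q\<close> above the limit, the probability bound is eventually below
  \<open>q\<close> along \<open>n = b * k\<close>, which forces at least \<open>a * k\<close>
  rounds. The limes superior over all \<open>n\<close> dominates the one along this subsequence, and
  \<open>q\<close> then tends to 1.\<close>

lemma C_const_HAM_ge: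
  assumes less_1: "2 * (1 - exp (- s) * (1 + s + s ^ 2 / 2))
      + exp (- s) * (1 + s) * (2 - exp (- s) * (2 + s))
      + 4 * (1 - exp (- s) * (1 + s + s ^ 2 / 2 + s ^ 3 / 6 + s ^ 4 / 24)) < 1" (is "?L < 1")
  shows "ereal s \<le> C_const HAM"
proof -
  have ev: "ereal s \<le> limsup (\<lambda>n. ereal_of_enat (rounds HAM q n) / ereal (real n))" if q: "?L < q" for q
  proof -
    let ?X = "\<lambda>n. ereal_of_enat (rounds HAM q n) / ereal (real n)"
    have "\<forall>\<^sub>F k in sequentially. ereal s \<le> (?X \<circ> (\<lambda>k. b * k)) k"
      using order_tendstoD(2)[OF tendsto_prob_HAM_bound q] eventually_gt_at_top[of 1]
    proof eventually_elim
      case (elim k)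
      have n: "2 \<le> b * k" using b_k_gt_1(1)[OF elim(2)] by simp
      have "enat (a * k) \<le> rounds HAM q (b * k)"
        using elim(1) by (intro rounds_HAM_ge le_less_trans[OF prob_HAM_le[OF n]]) (simp_all add: Let_def)
      then have "ereal_of_enat (enat (a * k)) \<le> ereal_of_enat (rounds HAM q (b * k))"
        by (simp only: ereal_of_enat_le_iff)
      then have "ereal_of_enat (enat (a * k)) / ereal (real (b * k)) \<le> ?X (b * k)"
        using ab elim(2) by (intro ereal_divide_right_mono) auto
      moreover have "ereal_of_enat (enat (a * k)) / ereal (real (b * k)) = ereal s"
        using ab elim(2) by (simp add: s_def)
      ultimately show ?case by simp
    qed
    then have "ereal s \<le> limsup (?X \<circ> (\<lambda>k. b * k))"
      by (intro le_Limsup) auto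
    also have "\<dots> \<le> limsup ?X"
      using ab by (intro limsup_subseq_mono) (simp add: strict_mono_def)
    finally show ?thesis .
  qed
  have "\<forall>\<^sub>F q in at_left 1. ?L < q"
    using less_1 eventually_at_left by blast
  then have "\<forall>\<^sub>F q in at_left 1. ereal s \<le> limsup (\<lambda>n. ereal_of_enat (rounds HAM q n) / ereal (real n))"
    by eventually_elim (rule ev)
  then show ?thesis
    using tendsto_lowerbound[OF C_const_tendsto] by simp
qed

end

text \<open>The fraction 19/15, about 1.26667, has a small denominator and lies just above the root;
  the expression there is about 0.9985.\<close>

lemma limit_bound_less_1:
  fixes s :: real
  assumes s: "s = 19 / 15"
  shows "2 * (1 - exp (- s) * (1 + s + s ^ 2 / 2))
      + exp (- s) * (1 + s) * (2 - exp (- s) * (2 + s))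
      + 4 * (1 - exp (- s) * (1 + s + s ^ 2 / 2 + s ^ 3 / 6 + s ^ 4 / 24)) < 1"
proof -
  define e where "e = exp (- s)"
  have e: "28175 / 100000 \<le> e"
    using exp_neg_bounds(2)[of "19 / 15"] unfolding e_def s
    by (simp add: lessThan_nat_numeral fact_numeral power_divide)
  have "(28175 / 100000)\<^sup>2 \<le> e\<^sup>2" using e by (intro power_mono) auto
  then have e2: "79383 / 1000000 \<le> e\<^sup>2" by (simp add: power_divide)
  \<comment> \<open>After expansion \<open>e\<close> and \<open>e\<^sup>2\<close> have negative
    coefficients, so the lower bounds \<open>e\<close> and \<open>e2\<close>, both rounded down,
    suffice.\<close>
  have "2 * (1 - e * (1 + s + s ^ 2 / 2)) + e * (1 + s) * (2 - e * (2 + s))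
      + 4 * (1 - e * (1 + s + s ^ 2 / 2 + s ^ 3 / 6 + s ^ 4 / 24))
    = 6 - e * (4 + 4 * s + 3 * s ^ 2 + 2 * s ^ 3 / 3 + s ^ 4 / 6) - e\<^sup>2 * ((1 + s) * (2 + s))"
    by (simp add: algebra_simps power2_eq_square)
  also have "\<dots> < 1" using e e2 unfolding s by (simp add: power_divide)
  finally show ?thesis unfolding e_def .
qed

theorem theorem1p2:
  fixes \<beta> :: real
  assumes "\<beta> > 0" and "f_HAM \<beta> - 1 = 0"
  shows "C_const HAM \<ge> ereal \<beta>"
proof -
  \<comment> \<open>The root lies below 1.26576, so the bound at 19/15 is slightly stronger than the
    claim.\<close>
  have "\<beta> \<le> real 19 / real 15"
    using f_HAM_root_approx[OF assms] by simp
  then have "ereal \<beta> \<le> ereal (real 19 / real 15)" by simp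
  also have "\<dots> \<le> C_const HAM"
    by (rule C_const_HAM_ge[OF _ _ limit_bound_less_1]) simp_all
  finally show ?thesis .
qed

end
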